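(* Let $\mathrm{a}_{n,k}^{\mathrm{des}}(123,132)$ denote the number of permutations of $\{1,\dots,n\}$ that avoid both $123$ and $132$ and have exactly $k$ descents. Then for all integers $n\ge1$ and $k\ge0$, $$\mathrm{a}_{n,k}^{\mathrm{des}}(123,132)=\binom{n}{2(n-k-1)}.$$
   Context: $\mathcal{S}_n$ is the set of permutations $\pi=\pi_1\cdots\pi_n$ of $\{1,\dots,n\}$. For $\rho\in\mathcal{S}_m$, $\pi\in\mathcal{S}_n$ contains $\rho$ if there are indices $1\le i_1<\cdots<i_m\le n$ such that $\pi_{i_a}<\pi_{i_b}$ if and only if $\rho_a<\rho_b$; otherwise $\pi$ avoids $\rho$. The number of descents is $\mathrm{des}(\pi)=|\{i:\pi_i>\pi_{i+1}\}|$, where $1\le i\le n-1$. Binomial coefficients $\binom{m}{j}$ (with $m\ge0$) are $0$ when the integer $j$ satisfies $j<0$ or $j>m$. *)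

theory Defs
  imports "HOL-Combinatorics.Multiset_Permutations"
begin

text \<open>
  A permutation of \<open>{1..n}\<close> is the list \<open>[\<pi>\<^sub>1, \<dots>, \<pi>\<^sub>n]\<close> of its values, so
  \<open>\<pi>\<^sub>i\<close> is \<open>\<pi> ! (i - 1)\<close>: positions are counted from 0, values from 1.
\<close>

definition Sym :: "nat \<Rightarrow> nat list set" where
  "Sym n = permutations_of_set {1..n}"

definition contains :: "nat list \<Rightarrow> nat list \<Rightarrow> bool" where
  "contains \<pi> \<rho> \<longleftrightarrow>
     (\<exists>i :: nat \<Rightarrow> nat.
        strict_mono_on {..<length \<rho>} i \<and>
        (\<forall>a<length \<rho>. i a < length \<pi>) \<and>
        (\<forall>a<length \<rho>. \<forall>b<length \<rho>. \<pi> ! i a < \<pi> ! i b \<longleftrightarrow> \<rho> ! a < \<rho> ! b))"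

definition avoids :: "nat list \<Rightarrow> nat list \<Rightarrow> bool" where
  "avoids \<pi> \<rho> \<longleftrightarrow> \<not> contains \<pi> \<rho>"

definition des :: "nat list \<Rightarrow> nat" where
  "des \<pi> = card {i. Suc i < length \<pi> \<and> \<pi> ! i > \<pi> ! Suc i}"

definition a_des :: "nat \<Rightarrow> nat \<Rightarrow> nat list set \<Rightarrow> nat" where
  "a_des n k P = card {\<pi> \<in> Sym n. (\<forall>\<rho>\<in>P. avoids \<pi> \<rho>) \<and> des \<pi> = k}"

text \<open>
  Binomial coefficient with an integer lower index, \<open>0\<close> if that index is negative;
  for \<open>j > m\<close> it is \<open>0\<close> because \<open>m choose nat j\<close> is.
\<close>

definition binom :: "nat \<Rightarrow> int \<Rightarrow> nat" where
  "binom m j = (if j < 0 then 0 else m choose nat j)"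

end

theory Submission
  imports Defs
begin

text \<open>
  Avoiding both patterns means that every entry has at most one larger entry to its right, so such
  a permutation of a set \<open>S\<close> starts with one of the two largest elements of \<open>S\<close>. Prepending the
  maximum always creates a descent; prepending the second largest element creates an ascent exactly
  if the rest starts with its maximum. Counting by the number \<open>j\<close> of ascents, the permutations
  that start with the maximum are therefore counted by \<open>n choose (2 * j)\<close> and the others by
  \<open>n choose (2 * j - 1)\<close>, where \<open>n + 1\<close> is the size of \<open>S\<close>: both recurrences are Pascal's rule.
\<close>

section \<open>Avoidance of both patterns as a condition on larger entries to the right\<close>

text \<open>Recursive on the list because the count builds permutations by prepending one entry at a
  time, which adds just one condition.\<close>

fun one_larger_right :: "'a::linorder list \<Rightarrow> bool" where
  "one_larger_right [] \<longleftrightarrow> True"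
| "one_larger_right (x # xs) \<longleftrightarrow>
     (\<forall>y\<in>set xs. \<forall>z\<in>set xs. x < y \<longrightarrow> x < z \<longrightarrow> y = z) \<and> one_larger_right xs"

text \<open>Passes to index triples, the language of pattern containment. Distinctness lets equality
  of values stand for equality of positions.\<close>

lemma one_larger_right_iff_nth:
  assumes "distinct xs"
  shows "one_larger_right xs \<longleftrightarrow>
    (\<forall>k<length xs. \<forall>j<k. \<forall>i<j. \<not> (xs ! i < xs ! j \<and> xs ! i < xs ! k))"
  using assms
proof (induction xs)
  case (Cons x xs)
  have "(\<forall>y\<in>set xs. \<forall>z\<in>set xs. x < y \<longrightarrow> x < z \<longrightarrow> y = z) \<longleftrightarrow>
      (\<forall>k<length xs. \<forall>j<k. \<not> (x < xs ! j \<and> x < xs ! k))" (is "?L \<longleftrightarrow> ?R")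
  proof
    assume ?L
    show ?R
    proof (intro allI impI notI)
      fix k j assume "k < length xs" "j < k" "x < xs ! j \<and> x < xs ! k"
      with \<open>?L\<close> have "xs ! j = xs ! k" by auto
      with Cons.prems \<open>k < length xs\<close> \<open>j < k\<close> show False by (simp add: nth_eq_iff_index_eq)
    qed
  next
    assume ?R
    show ?L
    proof (intro ballI impI)
      fix y z assume "y \<in> set xs" "z \<in> set xs" "x < y" "x < z"
      then obtain a b where "a < length xs" "b < length xs" "y = xs ! a" "z = xs ! b"
        by (auto simp: in_set_conv_nth)
      with \<open>?R\<close> \<open>x < y\<close> \<open>x < z\<close> show "y = z"
        by (cases a b rule: linorder_cases) auto
    qed
  qed
  moreover have "(\<forall>k<length (x # xs). \<forall>j<k. \<forall>i<j.
        \<not> ((x # xs) ! i < (x # xs) ! j \<and> (x # xs) ! i < (x # xs) ! k)) \<longleftrightarrow>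
      (\<forall>k<length xs. \<forall>j<k. \<not> (x < xs ! j \<and> x < xs ! k) \<and>
        (\<forall>i<j. \<not> (xs ! i < xs ! j \<and> xs ! i < xs ! k)))"
    by (simp add: All_less_Suc2)
  ultimately show ?case
    using Cons by auto
qed simp

text \<open>Replaces the embedding function of \<open>contains_def\<close> by three explicit
  indices. Comparisons of an entry with itself are false on both sides, so six comparisons
  remain.\<close>

lemma contains_three_iff:
  "contains \<pi> [a, b, c] \<longleftrightarrow>
    (\<exists>k<length \<pi>. \<exists>j<k. \<exists>i<j.
      (\<pi> ! i < \<pi> ! j \<longleftrightarrow> a < b) \<and> (\<pi> ! i < \<pi> ! k \<longleftrightarrow> a < c) \<and>
      (\<pi> ! j < \<pi> ! i \<longleftrightarrow> b < a) \<and> (\<pi> ! j < \<pi> ! k \<longleftrightarrow> b < c) \<and>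
      (\<pi> ! k < \<pi> ! i \<longleftrightarrow> c < a) \<and> (\<pi> ! k < \<pi> ! j \<longleftrightarrow> c < b))" (is "_ \<longleftrightarrow> ?R")
proof
  assume "contains \<pi> [a, b, c]"
  then obtain f :: "nat \<Rightarrow> nat" where f: "strict_mono_on {..<3} f" "\<forall>a<3. f a < length \<pi>"
    "\<forall>x<3. \<forall>y<3. \<pi> ! f x < \<pi> ! f y \<longleftrightarrow> [a, b, c] ! x < [a, b, c] ! y"
    unfolding contains_def by (auto simp: numeral_3_eq_3)
  have "f 0 < f 1" "f 1 < f 2"
    using strict_mono_onD[OF f(1), of 0 1] strict_mono_onD[OF f(1), of 1 2] by auto
  moreover have "f 2 < length \<pi>" using f(2) by simp
  moreover note f(3)[rule_format, of 0 1] f(3)[rule_format, of 0 2] f(3)[rule_format, of 1 0]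
    f(3)[rule_format, of 1 2] f(3)[rule_format, of 2 0] f(3)[rule_format, of 2 1]
  ultimately show ?R
    by (intro exI[of _ "f 2"] exI[of _ "f 1"] exI[of _ "f 0"] conjI) simp_all
next
  assume ?R
  then obtain i j k where *: "k < length \<pi>" "j < k" "i < j"
      "(\<pi> ! i < \<pi> ! j \<longleftrightarrow> a < b) \<and> (\<pi> ! i < \<pi> ! k \<longleftrightarrow> a < c) \<and>
      (\<pi> ! j < \<pi> ! i \<longleftrightarrow> b < a) \<and> (\<pi> ! j < \<pi> ! k \<longleftrightarrow> b < c) \<and>
      (\<pi> ! k < \<pi> ! i \<longleftrightarrow> c < a) \<and> (\<pi> ! k < \<pi> ! j \<longleftrightarrow> c < b)" by blast
  then show "contains \<pi> [a, b, c]"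
    unfolding contains_def
    by (intro exI[of _ "\<lambda>x. [i, j, k] ! x"])
      (auto simp: strict_mono_on_def All_less_Suc2 lessThan_Suc)
qed

text \<open>Both patterns start with their least entry and list the other two in either order, so an
  occurrence of one of them is an entry with two larger entries to its right.\<close>

lemma avoids_123_132_iff:
  assumes "distinct \<pi>"
  shows "avoids \<pi> [1, 2, 3] \<and> avoids \<pi> [1, 3, 2] \<longleftrightarrow> one_larger_right \<pi>"
proof -
  have "contains \<pi> [1, 2, 3] \<or> contains \<pi> [1, 3, 2] \<longleftrightarrow>
      (\<exists>k<length \<pi>. \<exists>j<k. \<exists>i<j. \<pi> ! i < \<pi> ! j \<and> \<pi> ! i < \<pi> ! k)" (is "?L \<longleftrightarrow> ?R")
  proof
    assume ?L
    then show ?R by (fastforce simp: contains_three_iff)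
  next
    assume ?R
    then obtain i j k where *: "k < length \<pi>" "j < k" "i < j" "\<pi> ! i < \<pi> ! j" "\<pi> ! i < \<pi> ! k"
      by blast
    with assms have "\<pi> ! j \<noteq> \<pi> ! k" by (simp add: nth_eq_iff_index_eq)
    then consider "\<pi> ! j < \<pi> ! k" | "\<pi> ! k < \<pi> ! j" by linarith
    then show ?L
    proof cases
      case 1
      with * have "contains \<pi> [1, 2, 3]"
        unfolding contains_three_iff
        by (intro exI[of _ k] exI[of _ j] exI[of _ i] conjI) auto
      then show ?thesis ..
    next
      case 2
      with * have "contains \<pi> [1, 3, 2]"
        unfolding contains_three_iff
        by (intro exI[of _ k] exI[of _ j] exI[of _ i] conjI) auto
      then show ?thesis ..
    qed
  qed
  then show ?thesis
    unfolding avoids_def one_larger_right_iff_nth[OF assms] by blast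
qed

section \<open>Descents under prepending\<close>

lemma des_Cons: "des (x # xs) = of_bool (xs \<noteq> [] \<and> hd xs < x) + des xs"
proof -
  let ?D = "{i. Suc i < length xs \<and> xs ! i > xs ! Suc i}"
  have "{i. Suc i < length (x # xs) \<and> (x # xs) ! i > (x # xs) ! Suc i} =
      (if xs \<noteq> [] \<and> hd xs < x then {0} else {}) \<union> Suc ` ?D" (is "?A = ?B")
  proof (rule set_eqI)
    fix i show "i \<in> ?A \<longleftrightarrow> i \<in> ?B"
      by (cases i) (auto simp: hd_conv_nth)
  qed
  moreover have "finite ?D" by (rule finite_subset[of _ "{..<length xs}"]) auto
  ultimately show ?thesis
    by (auto simp: des_def card_image)
qed

lemma des_le: "des xs \<le> length xs - 1"
proof -
  have "des xs \<le> card {..<length xs - 1}"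
    unfolding des_def by (rule card_mono) auto
  then show ?thesis by simp
qed

section \<open>Counting by the number of ascents and the first entry\<close>

text \<open>
  The condition \<open>des xs + j = n\<close> says that \<open>xs\<close> has \<open>j\<close> ascents.
\<close>

lemma card_one_larger_right_by_hd:
  assumes "finite S" "card S = Suc n"
  shows "card {xs \<in> permutations_of_set S.
           one_larger_right xs \<and> des xs + j = n \<and> hd xs = Max S} = n choose (2 * j) \<and>
         card {xs \<in> permutations_of_set S.
           one_larger_right xs \<and> des xs + j = n \<and> hd xs \<noteq> Max S} =
           (if j = 0 then 0 else n choose (2 * j - 1))"
  using assms
proof (induction n arbitrary: S j)
  case 0
  then obtain a where "S = {a}" by (metis One_nat_def card_1_singletonE)
  moreover have "des [a] = 0" by (simp add: des_def)
  \<comment> \<open>A one-entry list has no ascents and starts with its maximum, so only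
    \<open>j = 0\<close> in the first class contributes.\<close>
  ultimately have eqs:
    "{xs \<in> permutations_of_set S. one_larger_right xs \<and> des xs + j = 0 \<and> hd xs = Max S} =
       (if j = 0 then {[a]} else {})"
    "{xs \<in> permutations_of_set S. one_larger_right xs \<and> des xs + j = 0 \<and> hd xs \<noteq> Max S} = {}"
    by auto
  show ?case unfolding eqs by simp
next
  case (Suc n)
  define good where "good S n j = {xs \<in> permutations_of_set S. one_larger_right xs \<and> des xs + j = n}"
    for S and n j :: nat
  \<comment> \<open>\<open>M\<close> and \<open>m\<close> are the two largest elements of
    \<open>S\<close>; \<open>T\<close> and \<open>U\<close> are the entries left after a head
    \<open>M\<close> or \<open>m\<close>, respectively.\<close>
  define M where "M = Max S"
  define T where "T = S - {M}"
  define m where "m = Max T"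
  define U where "U = S - {m}"
  have "S \<noteq> {}" using Suc.prems by auto
  then have M: "M \<in> S" "\<And>x. x \<in> S \<Longrightarrow> x \<le> M"
    using Suc.prems by (auto simp: M_def)
  have T: "finite T" "card T = Suc n"
    using Suc.prems M by (auto simp: T_def)
  then have "T \<noteq> {}" by auto
  then have m: "m \<in> T" "\<And>x. x \<in> T \<Longrightarrow> x \<le> m"
    using T by (auto simp: m_def)
  have mM: "m \<in> S" "m < M" using m M by (auto simp: T_def order_less_le)
  have U: "finite U" "card U = Suc n" using Suc.prems mM by (auto simp: U_def)
  then have "U \<noteq> {}" by auto
  have MaxU: "Max U = M"
    using U M mM by (intro Max_eqI) (auto simp: U_def)
  have hdT: "hd xs \<in> T" "xs \<noteq> []" if "xs \<in> permutations_of_set T" for xs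
    using that \<open>T \<noteq> {}\<close> by (cases xs; auto simp: permutations_of_set_def)+
  have hdU: "hd xs \<in> U" "xs \<noteq> []" if "xs \<in> permutations_of_set U" for xs
    using that \<open>U \<noteq> {}\<close> by (cases xs; auto simp: permutations_of_set_def)+
  have goodT: "finite (good T n j)" and goodU: "finite (good U n j)" for j
    by (auto simp: good_def)

  \<comment> \<open>A head \<open>M\<close> has nothing larger to its right and adds one descent, so
    \<open>n\<close> grows by one while \<open>j\<close> stays.\<close>
  have max_eq: "{xs \<in> good S (Suc n) j. hd xs = M} = (#) M ` good T n j"
  proof (intro equalityI subsetI)
    fix xs assume xs: "xs \<in> {xs \<in> good S (Suc n) j. hd xs = M}"
    with \<open>S \<noteq> {}\<close> have "xs \<noteq> []" by (auto simp: good_def permutations_of_set_def)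
    with xs obtain t where t: "xs = M # t" by (cases xs) auto
    with xs have tT: "t \<in> permutations_of_set T"
      by (auto simp: good_def permutations_of_set_def T_def)
    with hdT[OF tT] M have "hd t < M" by (auto simp: T_def order_less_le)
    with xs t tT hdT[OF tT] show "xs \<in> (#) M ` good T n j"
      by (auto simp: good_def des_Cons)
  next
    fix xs assume "xs \<in> (#) M ` good T n j"
    then obtain t where t: "xs = M # t" "t \<in> good T n j" by auto
    then have tT: "t \<in> permutations_of_set T" by (simp add: good_def)
    with hdT[OF tT] M have "hd t < M" by (auto simp: T_def order_less_le)
    moreover have "M # t \<in> permutations_of_set S" "set t = T"
      using tT M by (auto simp: permutations_of_set_def T_def)
    moreover have "\<not> M < y" if "y \<in> T" for y using that M by (auto simp: T_def not_less)
    ultimately show "xs \<in> {xs \<in> good S (Suc n) j. hd xs = M}"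
      using t hdT[OF tT] by (auto simp: good_def des_Cons)
  qed

  \<comment> \<open>A tail starting with \<open>M\<close> gives an ascent after \<open>m\<close> and
    so has \<open>j - 1\<close> ascents itself; any other tail gives a descent. The case
    \<open>j = 0\<close> is set apart because \<open>j - 1\<close> truncates to
    \<open>0\<close>.\<close>
  have nonmax_eq: "{xs \<in> good S (Suc n) j. hd xs \<noteq> M} =
      (#) m ` ((if j = 0 then {} else {xs \<in> good U n (j - 1). hd xs = M}) \<union>
               {xs \<in> good U n j. hd xs \<noteq> M})" (is "?A = ?B")
  proof (intro equalityI subsetI)
    fix xs assume xs: "xs \<in> ?A"
    with \<open>S \<noteq> {}\<close> have "xs \<noteq> []" by (auto simp: good_def permutations_of_set_def)
    then obtain x t where t: "xs = x # t" by (cases xs) auto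
    with xs have x: "x \<in> S" "x \<noteq> M" "set t = S - {x}" "distinct t"
      "\<forall>y\<in>set t. \<forall>z\<in>set t. x < y \<longrightarrow> x < z \<longrightarrow> y = z"
      by (auto simp: good_def permutations_of_set_def)
    have "x = m"
    proof (rule ccontr)
      \<comment> \<open>Then \<open>m\<close> and \<open>M\<close> would be two distinct larger
        entries to the right of \<open>x\<close>.\<close>
      assume "x \<noteq> m"
      with m x have "x < m" by (auto simp: T_def order_less_le)
      with x mM M show False by (metis Diff_iff less_trans order_less_irrefl singletonD)
    qed
    with x have tU: "t \<in> permutations_of_set U"
      by (auto simp: permutations_of_set_def U_def)
    have "hd t < m \<longleftrightarrow> hd t \<noteq> M"
      using hdU[OF tU] m mM by (auto simp: T_def U_def order_less_le)
    \<comment> \<open>For \<open>j = 0\<close> this rules out \<open>hd t = M\<close>: the ascent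
      would leave only \<open>des t\<close> descents where \<open>Suc n\<close> are
      required.\<close>
    moreover have "des t \<le> n"
      using des_le[of t] length_finite_permutations_of_set[OF tU] U by simp
    ultimately show "xs \<in> ?B"
      using xs t \<open>x = m\<close> tU hdU[OF tU]
      by (cases j) (auto simp: good_def des_Cons)
  next
    fix xs assume "xs \<in> ?B"
    then obtain t where t: "xs = m # t"
      "(hd t = M \<and> j \<noteq> 0 \<and> t \<in> good U n (j - 1)) \<or> (hd t \<noteq> M \<and> t \<in> good U n j)"
      by (auto split: if_splits)
    then have tU: "t \<in> permutations_of_set U" by (auto simp: good_def)
    have "hd t < m \<longleftrightarrow> hd t \<noteq> M"
      using hdU[OF tU] m mM by (auto simp: T_def U_def order_less_le)
    moreover have "m # t \<in> permutations_of_set S" "set t = U"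
      using tU mM by (auto simp: permutations_of_set_def U_def)
    moreover have "y = M" if "y \<in> U" "m < y" for y
      using that m(2)[of y] by (auto simp: U_def T_def)
    ultimately show "xs \<in> ?A"
      using t mM hdU[OF tU] by (cases j) (auto simp: good_def des_Cons)
  qed

  have IH: "card {xs \<in> good V n j. hd xs = Max V} = n choose (2 * j)"
    "card {xs \<in> good V n j. hd xs \<noteq> Max V} = (if j = 0 then 0 else n choose (2 * j - 1))"
    if "finite V" "card V = Suc n" for V j
    using Suc.IH[OF that, of j] by (simp_all add: good_def conj_assoc)

  have "card (good T n j) =
      card ({xs \<in> good T n j. hd xs = m} \<union> {xs \<in> good T n j. hd xs \<noteq> m})"
    by (rule arg_cong[where f = card]) auto
  also have "\<dots> = card {xs \<in> good T n j. hd xs = m} + card {xs \<in> good T n j. hd xs \<noteq> m}"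
    using goodT by (intro card_Un_disjoint) auto
  \<comment> \<open>Pascal's rule: \<open>n choose (2 * j)\<close> plus
    \<open>n choose (2 * j - 1)\<close>.\<close>
  also have "\<dots> = Suc n choose (2 * j)"
    using IH[OF T] by (cases j) (simp_all flip: m_def)
  finally have 1: "card {xs \<in> good S (Suc n) j. hd xs = M} = Suc n choose (2 * j)"
    unfolding max_eq by (simp add: card_image)

  have "card {xs \<in> good S (Suc n) j. hd xs \<noteq> M} =
      card (if j = 0 then {} else {xs \<in> good U n (j - 1). hd xs = M}) +
      card {xs \<in> good U n j. hd xs \<noteq> M}"
    unfolding nonmax_eq using goodU by (subst card_image, simp, intro card_Un_disjoint) auto
  \<comment> \<open>Pascal's rule again, now with \<open>n choose (2 * (j - 1))\<close> and
    \<open>n choose (2 * j - 1)\<close>. The induction hypothesis applies since \<open>M\<close> is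
    also the maximum of \<open>U\<close>.\<close>
  also have "\<dots> = (if j = 0 then 0 else Suc n choose (2 * j - 1))"
    using IH[OF U] by (cases j) (simp_all add: MaxU)
  finally show ?case
    using 1 by (simp add: good_def M_def conj_assoc)
qed

text \<open>Adding the two classes of first entries is one more use of Pascal's rule.\<close>

lemma card_one_larger_right:
  assumes "finite S" "card S = Suc n"
  shows "card {xs \<in> permutations_of_set S. one_larger_right xs \<and> des xs + j = n} =
    Suc n choose (2 * j)"
proof -
  let ?G = "\<lambda>P. {xs \<in> permutations_of_set S. one_larger_right xs \<and> des xs + j = n \<and> P (hd xs)}"
  have "card {xs \<in> permutations_of_set S. one_larger_right xs \<and> des xs + j = n} =
      card (?G (\<lambda>h. h = Max S) \<union> ?G (\<lambda>h. h \<noteq> Max S))"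
    by (rule arg_cong[where f = card]) auto
  also have "\<dots> = card (?G (\<lambda>h. h = Max S)) + card (?G (\<lambda>h. h \<noteq> Max S))"
    by (intro card_Un_disjoint) auto
  also have "\<dots> = Suc n choose (2 * j)"
    using card_one_larger_right_by_hd[OF assms, of j] by (cases j) simp_all
  finally show ?thesis .
qed

theorem proposition14:
  fixes n k :: nat
  assumes "n \<ge> 1"
  shows "a_des n k {[1, 2, 3], [1, 3, 2]} = binom n (2 * (int n - int k - 1))"
proof -
  obtain N where N: "n = Suc N" using assms by (cases n) auto
  have "a_des n k {[1, 2, 3], [1, 3, 2]} =
      card {xs \<in> permutations_of_set {1..n}. one_larger_right xs \<and> des xs = k}"
    unfolding a_des_def Sym_def
    by (rule arg_cong[where f = card])
      (auto simp: avoids_123_132_iff[symmetric] permutations_of_set_def)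
  also have "\<dots> = binom n (2 * (int n - int k - 1))"
  proof (cases "k \<le> N")
    \<comment> \<open>With \<open>N = n - 1\<close> adjacent pairs, \<open>k\<close> descents leave
      \<open>N - k\<close> ascents; \<open>k \<le> N\<close> keeps this subtraction from
      truncating.\<close>
    case True
    then have "{xs \<in> permutations_of_set {1..n}. one_larger_right xs \<and> des xs = k} =
        {xs \<in> permutations_of_set {1..n}. one_larger_right xs \<and> des xs + (N - k) = N}"
      by auto
    also have "card \<dots> = n choose (2 * (N - k))"
      using card_one_larger_right[of "{1..n}" N "N - k"] by (simp add: N)
    also have "2 * (N - k) = nat (2 * (int n - int k - 1))"
      using True N by simp
    finally show ?thesis using True N by (simp add: binom_def)
  next
    \<comment> \<open>Here \<open>k\<close> exceeds the number of adjacent pairs, and the lower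
      index of \<open>binom\<close> is negative, so both sides are \<open>0\<close>.\<close>
    case False
    have "des xs \<noteq> k" if "xs \<in> permutations_of_set {1..n}" for xs
      using des_le[of xs] length_finite_permutations_of_set[OF that] False N by simp
    then have "{xs \<in> permutations_of_set {1..n}. one_larger_right xs \<and> des xs = k} = {}"
      by auto
    then show ?thesis using False N by (simp add: binom_def)
  qed
  finally show ?thesis .
qed

end
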